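(* Let $K$ be a simplicial complex on $[m]$ and, for $k=1,\dots,m$, let $L_k$ be a simplicial complex on $[n_k]$ with $L_k\neq\{\,\},\Delta^{[n_k]}$. Let $\mathcal Z^*(K;L_1,\dots,L_m)^\circ$ be the dual of the composition complex $\mathcal Z^*(K;L_1,\dots,L_m)$ relative to $[n]=[n_1]\sqcup\cdots\sqcup[n_m]$ (disjoint union). Then $$\mathcal Z^*(K;L_1,\dots,L_m)^\circ=\mathcal Z^*(K^\circ;L_1^\circ,\dots,L_m^\circ),$$ where $K^\circ$ is the dual of $K$ relative to $[m]$ and $L_k^\circ$ is the dual of $L_k$ relative to $[n_k]$. So if $K$ and all $L_k$ are self dual ($X\cong X^\circ$, the dual being relative to its non-empty vertex set), then $\mathcal Z^*(K;L_1,\dots,L_m)$ is self dual.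
   Context: $[m]=\{1,\dots,m\}$. A simplicial complex on a finite set $S$ is a set of subsets of $S$ closed under taking subsets; ghost vertices, the void complex $\{\,\}$ (no simplices) and $\{\emptyset\}$ are allowed; $\Delta^S$ is the set of all subsets of $S$. The Alexander dual of $K$ relative to $S\ne\emptyset$ is $K^\circ=\{S\setminus\sigma:\sigma\subset S,\sigma\notin K\}$. $X*Y=\{\sigma\sqcup\tau:\sigma\in X,\tau\in Y\}$, with $\{\,\}*Z=\{\,\}$. The composition complex is $\mathcal Z^*(K;L_1,\dots,L_m)=\bigcup_{\tau\in K}Y_1*\cdots*Y_m$, where $Y_k=\Delta^{[n_k]}$ if $k\in\tau$ and $Y_k=L_k$ if $k\notin\tau$; it is a simplicial complex on $[n]$, void if $K=\{\,\}$.
   Formalization: In the last sentence, self-duality of K is strengthened: some isomorphism φ from K to K° must satisfy L_k ≅ L_{φ(k)} for all k. As printed it fails for K the path 1-2-3-4, L_1 = L_2 three isolated points, L_3 = L_4 = {∅} on one point. *)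

theory Defs
  imports Main
begin

text \<open>Vertices that lie in no simplex (ghost vertices), the void complex \<open>{}\<close> and
  the complex \<open>{{}}\<close> are allowed.\<close>

definition simplicial_complex :: "'v set \<Rightarrow> 'v set set \<Rightarrow> bool" where
  "simplicial_complex S X \<longleftrightarrow>
     finite S \<and> X \<subseteq> Pow S \<and> (\<forall>\<sigma>\<in>X. \<forall>\<tau>. \<tau> \<subseteq> \<sigma> \<longrightarrow> \<tau> \<in> X)"

abbreviation full_simplex :: "'v set \<Rightarrow> 'v set set" where
  "full_simplex S \<equiv> Pow S"

text \<open>The dual is only meaningful relative to a non-empty set \<open>S\<close>.\<close>

definition alexander_dual :: "'v set \<Rightarrow> 'v set set \<Rightarrow> 'v set set" where
  "alexander_dual S X = {S - \<sigma> | \<sigma>. \<sigma> \<subseteq> S \<and> \<sigma> \<notin> X}"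

text \<open>The join of a family of complexes indexed by \<open>I\<close>. The disjoint union of the vertex sets
  \<open>V k\<close> is \<open>Sigma I V\<close>; correspondingly \<open>Sigma I s\<close> is the disjoint union of the simplices
  \<open>s k\<close>. The lemmas below show that this is the iterated binary join.\<close>

definition join :: "'i set \<Rightarrow> ('i \<Rightarrow> 'v set set) \<Rightarrow> ('i \<times> 'v) set set" where
  "join I Y = {Sigma I s | s. \<forall>k\<in>I. s k \<in> Y k}"

lemma join_empty: "join {} Y = {{}}"
  by (auto simp: join_def)

lemma join_insert:
  assumes "k \<notin> I"
  shows "join (insert k I) Y = {\<sigma> \<union> {k} \<times> \<tau> | \<sigma> \<tau>. \<sigma> \<in> join I Y \<and> \<tau> \<in> Y k}"
proof (intro equalityI subsetI)
  fix A assume "A \<in> join (insert k I) Y"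
  then obtain s where s: "A = Sigma (insert k I) s" "\<forall>j\<in>insert k I. s j \<in> Y j"
    by (auto simp: join_def)
  have "A = Sigma I s \<union> {k} \<times> s k" using s(1) by auto
  moreover have "Sigma I s \<in> join I Y" using s(2) by (auto simp: join_def)
  ultimately show "A \<in> {\<sigma> \<union> {k} \<times> \<tau> | \<sigma> \<tau>. \<sigma> \<in> join I Y \<and> \<tau> \<in> Y k}"
    using s(2) by auto
next
  fix A assume "A \<in> {\<sigma> \<union> {k} \<times> \<tau> | \<sigma> \<tau>. \<sigma> \<in> join I Y \<and> \<tau> \<in> Y k}"
  then obtain s \<tau> where s: "A = Sigma I s \<union> {k} \<times> \<tau>" "\<forall>j\<in>I. s j \<in> Y j" "\<tau> \<in> Y k"
    by (auto simp: join_def)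
  have "A = Sigma (insert k I) (s(k := \<tau>))" using s(1) assms by (auto split: if_splits)
  moreover have "\<forall>j\<in>insert k I. (s(k := \<tau>)) j \<in> Y j" using s assms by auto
  ultimately show "A \<in> join (insert k I) Y" by (auto simp: join_def)
qed

text \<open>The composition complex of \<open>K\<close> on \<open>I\<close> and complexes \<open>L k\<close> on \<open>V k\<close>.\<close>

definition composition_complex ::
  "'i set \<Rightarrow> ('i \<Rightarrow> 'v set) \<Rightarrow> 'i set set \<Rightarrow> ('i \<Rightarrow> 'v set set) \<Rightarrow> ('i \<times> 'v) set set" where
  "composition_complex I V K L =
     (\<Union>\<tau>\<in>K. join I (\<lambda>k. if k \<in> \<tau> then full_simplex (V k) else L k))"

text \<open>\<open>f\<close> is an isomorphism from the complex \<open>X\<close> on \<open>S\<close> to the complex \<open>Y\<close> on \<open>T\<close>;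
  ghost vertices count as part of \<open>S\<close> and \<open>T\<close>.\<close>

definition simplicial_iso ::
  "('v \<Rightarrow> 'w) \<Rightarrow> 'v set \<Rightarrow> 'v set set \<Rightarrow> 'w set \<Rightarrow> 'w set set \<Rightarrow> bool" where
  "simplicial_iso f S X T Y \<longleftrightarrow> bij_betw f S T \<and> (\<lambda>\<sigma>. f ` \<sigma>) ` X = Y"

definition isomorphic_complexes ::
  "'v set \<Rightarrow> 'v set set \<Rightarrow> 'w set \<Rightarrow> 'w set set \<Rightarrow> bool" where
  "isomorphic_complexes S X T Y \<longleftrightarrow> (\<exists>f. simplicial_iso f S X T Y)"

definition self_dual :: "'v set \<Rightarrow> 'v set set \<Rightarrow> bool" where
  "self_dual S X \<longleftrightarrow> S \<noteq> {} \<and> isomorphic_complexes S X S (alexander_dual S X)"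

text \<open>Self-duality of \<open>K\<close> on \<open>I\<close> as a complex whose vertices \<open>k\<close> are labelled by the
  isomorphism types of the complexes \<open>L k\<close> on \<open>V k\<close>. It amounts to \<open>self_dual I K\<close> if the
  \<open>L k\<close> are pairwise isomorphic, and it follows from \<open>alexander_dual I K = K\<close>.
  With \<open>self_dual I K\<close> alone, compositions of self dual complexes need not be self dual: let
  \<open>K\<close> be the path 1-2-3-4, whose dual is the path 4-2-3-1, let \<open>L 1 = L 2\<close> be three isolated
  points and \<open>L 3 = L 4 = {{}}\<close> on one point. In the composition complex any two
  vertices span a simplex, but in its dual the vertices \<open>(3,1)\<close> and \<open>(4,1)\<close> do not.\<close>

definition labelled_self_dual ::
  "'i set \<Rightarrow> 'i set set \<Rightarrow> ('i \<Rightarrow> 'v set) \<Rightarrow> ('i \<Rightarrow> 'v set set) \<Rightarrow> bool" where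
  "labelled_self_dual I K V L \<longleftrightarrow> I \<noteq> {} \<and>
     (\<exists>\<phi>. simplicial_iso \<phi> I K I (alexander_dual I K) \<and>
          (\<forall>k\<in>I. isomorphic_complexes (V k) (L k) (V (\<phi> k)) (L (\<phi> k))))"

end

theory Submission
  imports Defs
begin

text \<open>
  A set \<open>A\<close> of vertices of the disjoint union \<open>Sigma I V\<close> is the family of its slices
  \<open>A `` {k} \<subseteq> V k\<close>. Call \<open>k\<close> bad for \<open>A\<close> if its slice is not a simplex of \<open>L k\<close>. Only the
  full simplex can absorb a bad slice, and \<open>K\<close> is closed under subsets, so \<open>A\<close> is a simplex
  of the composition complex exactly if its set of bad indices is a simplex of \<open>K\<close>
  (\<open>composition_complex_iff\<close>).

  This criterion makes the duality formula a double negation. Passing to the complement of \<open>A\<close>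
  complements every slice, so \<open>k\<close> is bad for the complement with respect to \<open>L\<close> exactly if it
  is not bad for \<open>A\<close> with respect to the duals of the \<open>L k\<close>. The two sets of bad indices are
  thus complementary in \<open>I\<close>, which is what the dual of \<open>K\<close> asks for
  (\<open>alexander_dual_composition_complex\<close>).

  For the self dual case, an isomorphism from \<open>K\<close> to its dual that respects the isomorphism
  types of the \<open>L k\<close>, combined with isomorphisms from the \<open>L k\<close> to their duals, permutes the
  blocks \<open>{k} \<times> V k\<close> and maps bad indices to bad indices
  (\<open>simplicial_iso_composition_complex\<close>); the duality formula identifies its target as the
  dual of the composition complex.
\<close>

section \<open>Alexander duals\<close>

lemma alexander_dual_iff:
  "A \<in> alexander_dual S X \<longleftrightarrow> A \<subseteq> S \<and> S - A \<notin> X"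
proof
  assume "A \<in> alexander_dual S X"
  then obtain \<sigma> where "A = S - \<sigma>" "\<sigma> \<subseteq> S" "\<sigma> \<notin> X"
    by (auto simp: alexander_dual_def)
  then show "A \<subseteq> S \<and> S - A \<notin> X" by (simp add: double_diff)
next
  assume A: "A \<subseteq> S \<and> S - A \<notin> X"
  then have "A = S - (S - A)" by blast
  with A show "A \<in> alexander_dual S X"
    unfolding alexander_dual_def by blast
qed

lemma alexander_dual_subset: "alexander_dual S X \<subseteq> Pow S"
  by (auto simp: alexander_dual_def)

lemma simplicial_complex_alexander_dual:
  assumes "simplicial_complex S X"
  shows "simplicial_complex S (alexander_dual S X)"
  unfolding simplicial_complex_def
proof (intro conjI ballI allI impI)
  show "finite S" using assms by (simp add: simplicial_complex_def)
  show "alexander_dual S X \<subseteq> Pow S" by (rule alexander_dual_subset)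
next
  fix \<sigma> \<tau> assume "\<sigma> \<in> alexander_dual S X" "\<tau> \<subseteq> \<sigma>"
  moreover from this have "S - \<sigma> \<subseteq> S - \<tau>" by blast
  ultimately show "\<tau> \<in> alexander_dual S X"
    using assms unfolding alexander_dual_iff simplicial_complex_def by blast
qed

section \<open>Simplices of the composition complex\<close>

lemma Sigma_slices: "A \<subseteq> Sigma I V \<Longrightarrow> A = (SIGMA k:I. A `` {k})"
  by auto

lemma join_iff:
  "A \<in> join I Y \<longleftrightarrow> fst ` A \<subseteq> I \<and> (\<forall>k\<in>I. A `` {k} \<in> Y k)"
proof
  assume "A \<in> join I Y"
  then obtain s where s: "A = Sigma I s" "\<forall>k\<in>I. s k \<in> Y k"
    by (auto simp: join_def)
  moreover have "A `` {k} = s k" if "k \<in> I" for k using s(1) that by auto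
  ultimately show "fst ` A \<subseteq> I \<and> (\<forall>k\<in>I. A `` {k} \<in> Y k)" by auto
next
  assume A: "fst ` A \<subseteq> I \<and> (\<forall>k\<in>I. A `` {k} \<in> Y k)"
  then have "A \<subseteq> (SIGMA k:I. UNIV)" by force
  then have "A = (SIGMA k:I. A `` {k})" by (rule Sigma_slices)
  with A show "A \<in> join I Y" unfolding join_def by blast
qed

lemma composition_complex_subset:
  assumes L: "\<And>k. k \<in> I \<Longrightarrow> L k \<subseteq> Pow (V k)"
  shows "composition_complex I V K L \<subseteq> Pow (Sigma I V)"
proof
  fix A assume "A \<in> composition_complex I V K L"
  then obtain \<tau> where A: "fst ` A \<subseteq> I"
    "\<forall>k\<in>I. A `` {k} \<in> (if k \<in> \<tau> then full_simplex (V k) else L k)"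
    by (auto simp: composition_complex_def join_iff)
  have "A `` {k} \<subseteq> V k" if "k \<in> I" for k
    using A(2)[rule_format, OF that] L[OF that] by (cases "k \<in> \<tau>") auto
  then show "A \<in> Pow (Sigma I V)" using A(1) by force
qed

text \<open>One face \<open>\<tau>\<close> of \<open>K\<close> admits \<open>A\<close> exactly if it contains all bad indices of \<open>A\<close>; since \<open>K\<close>
  is closed under subsets, the least candidate, the set of bad indices itself, decides.\<close>

lemma composition_complex_iff:
  assumes K: "simplicial_complex I K" and L: "\<And>k. k \<in> I \<Longrightarrow> L k \<subseteq> Pow (V k)"
  shows "A \<in> composition_complex I V K L \<longleftrightarrow>
           A \<subseteq> Sigma I V \<and> {k \<in> I. A `` {k} \<notin> L k} \<in> K"
    (is "_ \<longleftrightarrow> _ \<and> ?bad \<in> K")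
proof
  assume A: "A \<in> composition_complex I V K L"
  then obtain \<tau> where \<tau>: "\<tau> \<in> K"
    "\<forall>k\<in>I. A `` {k} \<in> (if k \<in> \<tau> then full_simplex (V k) else L k)"
    by (auto simp: composition_complex_def join_iff)
  have "?bad \<subseteq> \<tau>"
  proof
    fix k assume "k \<in> ?bad"
    then show "k \<in> \<tau>" using \<tau>(2)[rule_format, of k] by (cases "k \<in> \<tau>") auto
  qed
  then have "?bad \<in> K" using K \<tau>(1) unfolding simplicial_complex_def by blast
  moreover have "A \<subseteq> Sigma I V" using composition_complex_subset[where L = L and V = V, OF L] A by blast
  ultimately show "A \<subseteq> Sigma I V \<and> ?bad \<in> K" by blast
next
  assume A: "A \<subseteq> Sigma I V \<and> ?bad \<in> K"
  have "A \<in> join I (\<lambda>k. if k \<in> ?bad then full_simplex (V k) else L k)"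
    using A by (auto simp: join_iff)
  then show "A \<in> composition_complex I V K L"
    using A unfolding composition_complex_def by blast
qed

section \<open>Duality\<close>

text \<open>The indices that are bad for the complement of \<open>A\<close> are those that are not bad for \<open>A\<close>
  with respect to the dual complexes.\<close>

theorem alexander_dual_composition_complex:
  assumes K: "simplicial_complex I K" and L: "\<And>k. k \<in> I \<Longrightarrow> L k \<subseteq> Pow (V k)"
  shows "alexander_dual (Sigma I V) (composition_complex I V K L)
       = composition_complex I V (alexander_dual I K) (\<lambda>k. alexander_dual (V k) (L k))"
    (is "?D = ?C")
proof (rule set_eqI)
  fix A
  show "A \<in> ?D \<longleftrightarrow> A \<in> ?C"
  proof (cases "A \<subseteq> Sigma I V")
    case False
    moreover have "?C \<subseteq> Pow (Sigma I V)"
      by (rule composition_complex_subset[OF alexander_dual_subset])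
    ultimately show ?thesis by (auto simp only: alexander_dual_iff)
  next
    case True
    have slices: "(Sigma I V - A) `` {k} = V k - A `` {k}" "A `` {k} \<subseteq> V k" if "k \<in> I" for k
      using True that by auto
    have "A \<in> ?D \<longleftrightarrow> {k \<in> I. (Sigma I V - A) `` {k} \<notin> L k} \<notin> K"
      using True by (simp add: alexander_dual_iff composition_complex_iff[OF K L])
    also have "{k \<in> I. (Sigma I V - A) `` {k} \<notin> L k}
        = I - {k \<in> I. A `` {k} \<notin> alexander_dual (V k) (L k)}"
      using slices by (auto simp: alexander_dual_iff)
    also have "\<dots> \<notin> K \<longleftrightarrow>
        {k \<in> I. A `` {k} \<notin> alexander_dual (V k) (L k)} \<in> alexander_dual I K"
      by (auto simp: alexander_dual_iff)
    also have "\<dots> \<longleftrightarrow> A \<in> ?C"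
      using True
      by (simp add: composition_complex_iff
          [OF simplicial_complex_alexander_dual[OF K] alexander_dual_subset])
    finally show ?thesis .
  qed
qed

section \<open>Isomorphisms of composition complexes\<close>

lemma simplicial_iso_iff:
  assumes "X \<subseteq> Pow S" "Y \<subseteq> Pow T"
  shows "simplicial_iso f S X T Y \<longleftrightarrow>
           bij_betw f S T \<and> (\<forall>\<sigma>. \<sigma> \<subseteq> S \<longrightarrow> (f ` \<sigma> \<in> Y \<longleftrightarrow> \<sigma> \<in> X))"
proof (cases "bij_betw f S T")
  case True
  then have pow: "bij_betw ((`) f) (Pow S) (Pow T)" by (rule bij_betw_Pow)
  have "(`) f ` X = Y \<longleftrightarrow> (\<forall>\<sigma>\<in>Pow S. f ` \<sigma> \<in> Y \<longleftrightarrow> \<sigma> \<in> X)"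
  proof
    assume "(`) f ` X = Y"
    then show "\<forall>\<sigma>\<in>Pow S. f ` \<sigma> \<in> Y \<longleftrightarrow> \<sigma> \<in> X"
      using inj_on_image_mem_iff[OF bij_betw_imp_inj_on[OF pow] _ assms(1)] by auto
  next
    assume R: "\<forall>\<sigma>\<in>Pow S. f ` \<sigma> \<in> Y \<longleftrightarrow> \<sigma> \<in> X"
    show "(`) f ` X = Y"
    proof
      show "(`) f ` X \<subseteq> Y" using R assms(1) by blast
      show "Y \<subseteq> (`) f ` X"
      proof
        fix \<tau> assume "\<tau> \<in> Y"
        then have "\<tau> \<in> (`) f ` Pow S" unfolding bij_betw_imp_surj_on[OF pow] using assms(2) ..
        then obtain \<sigma> where "\<sigma> \<in> Pow S" "\<tau> = f ` \<sigma>" by (rule imageE)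
        with R \<open>\<tau> \<in> Y\<close> show "\<tau> \<in> (`) f ` X" by simp
      qed
    qed
  qed
  with True show ?thesis by (simp add: simplicial_iso_def Ball_def)
qed (simp add: simplicial_iso_def)

lemma simplicial_iso_trans:
  assumes "simplicial_iso f S X T Y" "simplicial_iso g T Y U Z"
  shows "simplicial_iso (g \<circ> f) S X U Z"
  unfolding simplicial_iso_def
proof
  show "bij_betw (g \<circ> f) S U"
    using assms unfolding simplicial_iso_def by (blast intro: bij_betw_trans)
  have "(\<lambda>\<sigma>. (g \<circ> f) ` \<sigma>) ` X = (\<lambda>\<tau>. g ` \<tau>) ` (\<lambda>\<sigma>. f ` \<sigma>) ` X"
    by (simp add: image_image)
  then show "(\<lambda>\<sigma>. (g \<circ> f) ` \<sigma>) ` X = Z"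
    using assms by (simp add: simplicial_iso_def)
qed

lemma isomorphic_complexes_trans:
  "isomorphic_complexes S X T Y \<Longrightarrow> isomorphic_complexes T Y U Z \<Longrightarrow>
    isomorphic_complexes S X U Z"
  unfolding isomorphic_complexes_def by (blast intro: simplicial_iso_trans)

definition block_map :: "('i \<Rightarrow> 'j) \<Rightarrow> ('i \<Rightarrow> 'v \<Rightarrow> 'w) \<Rightarrow> 'i \<times> 'v \<Rightarrow> 'j \<times> 'w" where
  "block_map \<phi> g = (\<lambda>(k, v). (\<phi> k, g k v))"

lemma bij_betw_block_map:
  assumes \<phi>: "bij_betw \<phi> I J" and g: "\<And>k. k \<in> I \<Longrightarrow> bij_betw (g k) (V k) (W (\<phi> k))"
  shows "bij_betw (block_map \<phi> g) (Sigma I V) (Sigma J W)"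
  unfolding bij_betw_def
proof
  show "inj_on (block_map \<phi> g) (Sigma I V)"
  proof (rule inj_onI, clarsimp simp: block_map_def)
    fix k v l w
    assume "k \<in> I" "v \<in> V k" "l \<in> I" "w \<in> V l" and eq: "\<phi> k = \<phi> l" "g k v = g l w"
    moreover from this have "k = l" using bij_betw_imp_inj_on[OF \<phi>] by (blast dest: inj_onD)
    ultimately show "k = l \<and> v = w"
      using bij_betw_imp_inj_on[OF g[of l]] by (blast dest: inj_onD)
  qed
  show "block_map \<phi> g ` Sigma I V = Sigma J W"
  proof
    show "block_map \<phi> g ` Sigma I V \<subseteq> Sigma J W"
      by (auto simp: block_map_def intro: bij_betw_apply[OF \<phi>] bij_betw_apply[OF g])
    show "Sigma J W \<subseteq> block_map \<phi> g ` Sigma I V"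
    proof (clarify)
      fix j w assume "j \<in> J" "w \<in> W j"
      then obtain k where k: "k \<in> I" "j = \<phi> k" using bij_betw_imp_surj_on[OF \<phi>] by blast
      then obtain v where "v \<in> V k" "w = g k v"
        using \<open>w \<in> W j\<close> bij_betw_imp_surj_on[OF g[OF k(1)]] by blast
      with k show "(j, w) \<in> block_map \<phi> g ` Sigma I V"
        by (force simp: block_map_def)
    qed
  qed
qed

lemma slice_block_map:
  assumes "inj_on \<phi> I" "A \<subseteq> Sigma I V" "k \<in> I"
  shows "(block_map \<phi> g ` A) `` {\<phi> k} = g k ` (A `` {k})"
proof (intro equalityI subsetI)
  fix w assume "w \<in> (block_map \<phi> g ` A) `` {\<phi> k}"
  then obtain l v where l: "(l, v) \<in> A" "\<phi> k = \<phi> l" "w = g l v"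
    by (auto simp: block_map_def)
  then have "l \<in> I" using assms(2) by blast
  with l assms(1,3) have "k = l" by (blast dest: inj_onD)
  with l show "w \<in> g k ` (A `` {k})" by blast
qed (force simp: block_map_def)

text \<open>The block map carries the slice at \<open>k\<close> to the slice at \<open>\<phi> k\<close>, and hence the set of bad
  indices of \<open>A\<close> to that of its image.\<close>

lemma simplicial_iso_composition_complex:
  assumes K: "simplicial_complex I K" and K': "simplicial_complex J K'"
    and L: "\<And>k. k \<in> I \<Longrightarrow> L k \<subseteq> Pow (V k)" and L': "\<And>j. j \<in> J \<Longrightarrow> L' j \<subseteq> Pow (W j)"
    and \<phi>: "simplicial_iso \<phi> I K J K'"
    and g: "\<And>k. k \<in> I \<Longrightarrow> simplicial_iso (g k) (V k) (L k) (W (\<phi> k)) (L' (\<phi> k))"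
  shows "simplicial_iso (block_map \<phi> g) (Sigma I V) (composition_complex I V K L)
           (Sigma J W) (composition_complex J W K' L')"
proof -
  have bij: "bij_betw \<phi> I J" using \<phi> by (simp add: simplicial_iso_def)
  have inj: "inj_on \<phi> I" and surj: "\<phi> ` I = J" using bij by (simp_all add: bij_betw_def)
  have block: "bij_betw (block_map \<phi> g) (Sigma I V) (Sigma J W)"
    using g by (intro bij_betw_block_map bij) (simp add: simplicial_iso_def)
  have "block_map \<phi> g ` A \<in> composition_complex J W K' L' \<longleftrightarrow> A \<in> composition_complex I V K L"
    if A: "A \<subseteq> Sigma I V" for A
  proof -
    have image: "block_map \<phi> g ` A \<subseteq> Sigma J W"
      using A bij_betw_imp_surj_on[OF block] by blast
    have slice: "(block_map \<phi> g ` A) `` {\<phi> k} \<in> L' (\<phi> k) \<longleftrightarrow> A `` {k} \<in> L k"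
      if "k \<in> I" for k
    proof -
      have "A `` {k} \<subseteq> V k" using A by auto
      moreover have "\<phi> k \<in> J" using surj that by blast
      moreover have "bij_betw (g k) (V k) (W (\<phi> k)) \<and>
          (\<forall>\<sigma>. \<sigma> \<subseteq> V k \<longrightarrow> (g k ` \<sigma> \<in> L' (\<phi> k) \<longleftrightarrow> \<sigma> \<in> L k))"
        using g[OF that] simplicial_iso_iff[OF L[OF that] L'[OF \<open>\<phi> k \<in> J\<close>]] by blast
      ultimately show ?thesis unfolding slice_block_map[OF inj A that] by blast
    qed
    have "block_map \<phi> g ` A \<in> composition_complex J W K' L'
        \<longleftrightarrow> {j \<in> J. (block_map \<phi> g ` A) `` {j} \<notin> L' j} \<in> K'"
      using image by (simp add: composition_complex_iff[OF K' L'])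
    also have "{j \<in> J. (block_map \<phi> g ` A) `` {j} \<notin> L' j} = \<phi> ` {k \<in> I. A `` {k} \<notin> L k}"
      using slice unfolding surj[symmetric] by blast
    also have "\<dots> \<in> K' \<longleftrightarrow> {k \<in> I. A `` {k} \<notin> L k} \<in> K"
      using \<phi> K K' simplicial_iso_iff[of K I K' J \<phi>] by (simp add: simplicial_complex_def)
    also have "\<dots> \<longleftrightarrow> A \<in> composition_complex I V K L"
      using A by (simp add: composition_complex_iff[OF K L])
    finally show ?thesis .
  qed
  then show ?thesis
    using block by (simp add: simplicial_iso_iff composition_complex_subset L L')
qed

section \<open>Self dual compositions\<close>

text \<open>The labelling matches \<open>L k\<close> with \<open>L (\<phi> k)\<close>, and self-duality of \<open>L (\<phi> k)\<close> then leads to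
  its dual, which is the label of \<open>\<phi> k\<close> in the dual composition.\<close>

theorem self_dual_composition_complex:
  assumes K: "simplicial_complex I K" and L: "\<And>k. k \<in> I \<Longrightarrow> L k \<subseteq> Pow (V k)"
    and labelled: "labelled_self_dual I K V L"
    and self: "\<And>k. k \<in> I \<Longrightarrow> self_dual (V k) (L k)"
  shows "self_dual (Sigma I V) (composition_complex I V K L)"
proof -
  obtain \<phi> where I: "I \<noteq> {}" and \<phi>: "simplicial_iso \<phi> I K I (alexander_dual I K)"
    and label: "\<And>k. k \<in> I \<Longrightarrow> isomorphic_complexes (V k) (L k) (V (\<phi> k)) (L (\<phi> k))"
    using labelled unfolding labelled_self_dual_def by blast
  have "isomorphic_complexes (V k) (L k) (V (\<phi> k)) (alexander_dual (V (\<phi> k)) (L (\<phi> k)))"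
    if "k \<in> I" for k
  proof -
    have "\<phi> k \<in> I" using \<phi> that by (auto simp: simplicial_iso_def bij_betw_def)
    then show ?thesis
      using isomorphic_complexes_trans[OF label[OF that]] self[of "\<phi> k"]
      unfolding self_dual_def by blast
  qed
  then obtain g where g: "\<And>k. k \<in> I \<Longrightarrow> simplicial_iso (g k) (V k) (L k) (V (\<phi> k))
      (alexander_dual (V (\<phi> k)) (L (\<phi> k)))"
    unfolding isomorphic_complexes_def by metis
  have dual: "alexander_dual (Sigma I V) (composition_complex I V K L)
      = composition_complex I V (alexander_dual I K) (\<lambda>k. alexander_dual (V k) (L k))"
    using K L by (rule alexander_dual_composition_complex)
  have "simplicial_iso (block_map \<phi> g) (Sigma I V) (composition_complex I V K L)
      (Sigma I V) (alexander_dual (Sigma I V) (composition_complex I V K L))"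
    unfolding dual
    using K simplicial_complex_alexander_dual[OF K] L alexander_dual_subset \<phi> g
    by (rule simplicial_iso_composition_complex)
  moreover have "Sigma I V \<noteq> {}" using I self by (auto simp: self_dual_def)
  ultimately show ?thesis unfolding self_dual_def isomorphic_complexes_def by blast
qed

theorem theorem5p6:
  fixes m :: nat and n :: "nat \<Rightarrow> nat"
    and K :: "nat set set" and L :: "nat \<Rightarrow> nat set set"
  assumes "1 \<le> m"
    and "simplicial_complex {1..m} K"
    and "\<And>k. k \<in> {1..m} \<Longrightarrow> simplicial_complex {1..n k} (L k)"
    and "\<And>k. k \<in> {1..m} \<Longrightarrow> L k \<noteq> {} \<and> L k \<noteq> full_simplex {1..n k}"
  shows
    "alexander_dual (SIGMA k:{1..m}. {1..n k})
         (composition_complex {1..m} (\<lambda>k. {1..n k}) K L)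
       = composition_complex {1..m} (\<lambda>k. {1..n k})
           (alexander_dual {1..m} K) (\<lambda>k. alexander_dual {1..n k} (L k))
     \<and> (labelled_self_dual {1..m} K (\<lambda>k. {1..n k}) L
          \<and> (\<forall>k\<in>{1..m}. self_dual {1..n k} (L k))
        \<longrightarrow> self_dual (SIGMA k:{1..m}. {1..n k})
              (composition_complex {1..m} (\<lambda>k. {1..n k}) K L))"
proof -
  have L: "L k \<subseteq> Pow {1..n k}" if "k \<in> {1..m}" for k
    using assms(3)[OF that] by (simp add: simplicial_complex_def)
  show ?thesis
  proof (intro conjI impI)
    show "alexander_dual (SIGMA k:{1..m}. {1..n k})
         (composition_complex {1..m} (\<lambda>k. {1..n k}) K L)
       = composition_complex {1..m} (\<lambda>k. {1..n k})
           (alexander_dual {1..m} K) (\<lambda>k. alexander_dual {1..n k} (L k))"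
      using assms(2) L by (rule alexander_dual_composition_complex)
  next
    assume "labelled_self_dual {1..m} K (\<lambda>k. {1..n k}) L
        \<and> (\<forall>k\<in>{1..m}. self_dual {1..n k} (L k))"
    then show "self_dual (SIGMA k:{1..m}. {1..n k})
        (composition_complex {1..m} (\<lambda>k. {1..n k}) K L)"
      by (intro self_dual_composition_complex assms(2) L) auto
  qed
qed

end
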